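(* Assume there exists $\hat\xi=(\hat q,\hat W,\hat T,\hat h)$ such that $Q(x,\hat\xi)\le\mathbb E_{\mathsf P_d}[Q(x,\xi)]$ for all $x\in\mathcal X$ and $d\in\mathcal D$, where $Q(x,\xi)$ is a linear program. Let $\rho^v$ be an optimal dual solution to $Q(x^v,\hat\xi)$ for some $x^v\in\mathcal X$. Then $$\mathbb E_{\mathsf P_{d^l}}[Q(x^l,\xi)]\ \ge\ (\rho^v)^\top(\hat h-\hat Tx^l)$$ for all $x^l\in\mathcal X$, where $d^l\in\mathcal D$ is such that $x^l\in\mathcal X_{d^l}$.
   Context: Setting: $\mathcal X\subseteq\mathbb R^{n_1}$, $\mathcal D$ is finite, $(\mathcal X_d)_{d\in\mathcal D}$ is a partition of $\mathcal X$. For each $d\in\mathcal D$, $\mathsf P_d$ is a discrete distribution with a finite set of scenarios $\mathcal S_d$, realizations $\xi_{sd}=(q_{sd},W_{sd},T_{sd},h_{sd})$ and probabilities $\pi_{sd}>0$, $\sum_{s\in\mathcal S_d}\pi_{sd}=1$, so $\mathbb E_{\mathsf P_d}[Q(x,\xi)]=\sum_{s\in\mathcal S_d}\pi_{sd}Q(x,\xi_{sd})$. The second stage is the linear program $Q(x,\xi)=\min_{y\ge0}\{q^\top y:Wy=h-Tx\}$ for $\xi=(q,W,T,h)$, $q\in\mathbb R^{n_2}$, $W\in\mathbb R^{m_2\times n_2}$, $T\in\mathbb R^{m_2\times n_1}$, $h\in\mathbb R^{m_2}$ ($+\infty$ if infeasible, $-\infty$ if unbounded); its dual is $\max\{\rho^\top(h-Tx):\rho^\top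 W\le q^\top\}$. *)

theory Defs
  imports "HOL-Analysis.Analysis"
begin

type_synonym ('n1, 'n2, 'm2) lp_data =
  "(real ^ 'n2) \<times> (real ^ 'n2 ^ 'm2) \<times> (real ^ 'n1 ^ 'm2) \<times> (real ^ 'm2)"

text \<open>
  Second-stage data are tuples \<open>(q, W, T, h)\<close>; the order on vectors is componentwise.
  In \<open>ereal\<close>, the infimum of the empty set is \<open>\<infinity>\<close> (infeasible program) and the infimum of a
  set of reals unbounded below is \<open>-\<infinity>\<close> (unbounded program).
\<close>

definition recourse :: "real ^ 'n1 \<Rightarrow> ('n1::finite, 'n2::finite, 'm2::finite) lp_data \<Rightarrow> ereal"
  where "recourse x = (\<lambda>(q, W, T, h).
    INF y \<in> {y. 0 \<le> y \<and> W *v y = h - T *v x}. ereal (q \<bullet> y))"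

definition optimal_dual_solution ::
    "real ^ 'n1 \<Rightarrow> ('n1::finite, 'n2::finite, 'm2::finite) lp_data \<Rightarrow> real ^ 'm2 \<Rightarrow> bool"
  where "optimal_dual_solution x = (\<lambda>(q, W, T, h).
    is_arg_max (\<lambda>\<rho>. \<rho> \<bullet> (h - T *v x)) (\<lambda>\<rho>. \<rho> v* W \<le> q))"

text \<open>
  If both infinities occur among the recourse values, the sum below is \<open>\<infinity>\<close>, because
  \<open>\<infinity> + (-\<infinity>) = \<infinity>\<close> in \<open>ereal\<close>; this is the usual convention for minimization.
\<close>

definition expected_recourse ::
    "'s set \<Rightarrow> ('s \<Rightarrow> real) \<Rightarrow> ('s \<Rightarrow> ('n1::finite, 'n2::finite, 'm2::finite) lp_data) \<Rightarrow>
     real ^ 'n1 \<Rightarrow> ereal"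
  where "expected_recourse S p \<xi> x = (\<Sum>s\<in>S. ereal (p s) * recourse x (\<xi> s))"

end

theory Submission imports Defs begin

text \<open>
  The bound is weak duality for the reference data \<open>(q', W', T', h')\<close>. The dual feasible set
  \<open>{\<rho>. \<rho> v* W' \<le> q'}\<close> does not involve the first-stage point, so a multiplier that is dual
  optimal at one point \<open>x\<^sub>v\<close> stays dual feasible at every other point \<open>x\<^sub>l\<close>. Its objective
  there, \<open>\<rho>\<^sub>v \<bullet> (h' - T' *v x\<^sub>l)\<close>, is thus a lower bound on the recourse value
  (\<open>dual_feasible_le_recourse\<close>), which by hypothesis lies below the expected recourse at
  \<open>x\<^sub>l\<close>.
\<close>

lemma inner_mono_left_nonneg:
  fixes a b y :: "real ^ 'n"
  assumes "a \<le> b" and "0 \<le> y"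
  shows "a \<bullet> y \<le> b \<bullet> y"
  using assms unfolding inner_vec_def
  by (auto simp: less_eq_vec_def intro!: sum_mono mult_right_mono)

text \<open>
  For a feasible \<open>y\<close>, associativity gives \<open>\<rho> \<bullet> (h - T *v x) = (\<rho> v* W) \<bullet> y\<close>, and \<open>y \<ge> 0\<close> turns
  the dual constraint into \<open>(\<rho> v* W) \<bullet> y \<le> q \<bullet> y\<close>. As the recourse value is an infimum in
  \<open>ereal\<close>, an infeasible program is covered as well, and a dual feasible \<open>\<rho>\<close> excludes the
  value \<open>-\<infinity>\<close>.
\<close>

lemma dual_feasible_le_recourse:
  fixes W :: "real ^ 'n2::finite ^ 'm2::finite" and T :: "real ^ 'n1::finite ^ 'm2"
  assumes "\<rho> v* W \<le> q"
  shows "ereal (\<rho> \<bullet> (h - T *v x)) \<le> recourse x (q, W, T, h)"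
  unfolding recourse_def prod.case
proof (rule INF_greatest)
  fix y assume "y \<in> {y. 0 \<le> y \<and> W *v y = h - T *v x}"
  then have "0 \<le> y" and feas: "W *v y = h - T *v x" by auto
  have "\<rho> \<bullet> (h - T *v x) = (\<rho> v* W) \<bullet> y"
    by (simp only: feas dot_lmul_matrix)
  also have "\<dots> \<le> q \<bullet> y"
    using assms \<open>0 \<le> y\<close> by (rule inner_mono_left_nonneg)
  finally show "ereal (\<rho> \<bullet> (h - T *v x)) \<le> ereal (q \<bullet> y)" by simp
qed

theorem proposition15:
  fixes X :: "(real ^ 'n1) set"
    and D :: "'d set"
    and X_of :: "'d \<Rightarrow> (real ^ 'n1) set"
    and S :: "'d \<Rightarrow> 's set"
    and p :: "'d \<Rightarrow> 's \<Rightarrow> real"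
    and \<xi> :: "'d \<Rightarrow> 's \<Rightarrow> ('n1::finite, 'n2::finite, 'm2::finite) lp_data"
    and q' :: "real ^ 'n2"
    and W' :: "real ^ 'n2 ^ 'm2"
    and T' :: "real ^ 'n1 ^ 'm2"
    and h' :: "real ^ 'm2"
    and x\<^sub>v x\<^sub>l :: "real ^ 'n1"
    and \<rho>\<^sub>v :: "real ^ 'm2"
    and d\<^sub>l :: 'd
  assumes "finite D"
    and "disjoint_family_on X_of D"
    and "(\<Union>d\<in>D. X_of d) = X"
    and "\<And>d. d \<in> D \<Longrightarrow> finite (S d)"
    and "\<And>d s. d \<in> D \<Longrightarrow> s \<in> S d \<Longrightarrow> 0 < p d s"
    and "\<And>d. d \<in> D \<Longrightarrow> (\<Sum>s\<in>S d. p d s) = 1"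
    and "\<And>x d. x \<in> X \<Longrightarrow> d \<in> D \<Longrightarrow>
           recourse x (q', W', T', h') \<le> expected_recourse (S d) (p d) (\<xi> d) x"
    and "x\<^sub>v \<in> X"
    and "optimal_dual_solution x\<^sub>v (q', W', T', h') \<rho>\<^sub>v"
    and "x\<^sub>l \<in> X" and "d\<^sub>l \<in> D" and "x\<^sub>l \<in> X_of d\<^sub>l"
  shows "expected_recourse (S d\<^sub>l) (p d\<^sub>l) (\<xi> d\<^sub>l) x\<^sub>l \<ge> ereal (\<rho>\<^sub>v \<bullet> (h' - T' *v x\<^sub>l))"
proof -
  have "\<rho>\<^sub>v v* W' \<le> q'"
    using assms(9) by (simp add: optimal_dual_solution_def is_arg_max_def)
  then have "ereal (\<rho>\<^sub>v \<bullet> (h' - T' *v x\<^sub>l)) \<le> recourse x\<^sub>l (q', W', T', h')"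
    by (rule dual_feasible_le_recourse)
  also have "\<dots> \<le> expected_recourse (S d\<^sub>l) (p d\<^sub>l) (\<xi> d\<^sub>l) x\<^sub>l"
    using assms(10,11) by (rule assms(7))
  finally show ?thesis .
qed

end
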